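(* Let $K$ be a number field of degree $d$, and let $$\mathcal{H}_K=\Big\{\mathcal{L}(\mathbf{x},T):\ \mathbf{x}\in\iota_S(K),\ T\subseteq S\text{ with }\#T_{\mathbb{R}}+2\,\#T_{\mathbb{C}}>\tfrac d2\Big\}.$$ Then for every $\mathcal{L}\in\mathcal{H}_K$, $\ \mathcal{L}\cap\mathbf{BA}_K=\varnothing$.
   Context: $K$ is a number field of degree $d$ with ring of integers $\mathcal{O}$; $S$ is the set of Archimedean places of $K$ (one for each real embedding and one for each conjugate pair of complex embeddings). For $v\in S$, $K_v\cong\mathbb{R}$ or $\mathbb{C}$ is the completion with its usual absolute value $|\cdot|$, and $\iota_v:K\to K_v$ is the embedding. $K_S=\prod_{v\in S}K_v$, with coordinatewise multiplication and norm $\|\mathbf{x}\|=\max_{v\in S}|x_v|$, and $\iota_S:K\to K_S$, $r\mapsto(\iota_v(r))_{v\in S}$. An element $\mathbf{x}\in K_S$ is badly approximable if there is $c>0$ such that $\|\iota_S(q)\cdot\mathbf{x}+\iota_S(p)\|>c\,\|\iota_S(q)\|^{-1}$ for all $p\in\mathcal{O}$, $q\in\mathcal{O}\smallsetminus\{0\}$; $\mathbf{BA}_K$ is the set of all such $\mathbf{x}$. For $T\subseteq S$, $T_{\mathbb{R}}=\{v\in T:K_v\cong\mathbb{R}\}$, $T_{\mathbb{C}}=\{v\in T:K_v\cong\mathbb{C}\}$, and for $\mathbf{x}\in K_S$, $\mathcal{L}(\mathbf{x},T)=\{\mathbf{y}\in K_S:\ y_v=x_v\ \forall v\in T\}$.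 *)

theory Defs
  imports
    "HOL-Analysis.Analysis"
    "HOL-Computational_Algebra.Polynomial"
begin

section \<open>Number fields\<close>

abbreviation (input) rat_scale :: "rat \<Rightarrow> 'k::field_char_0 \<Rightarrow> 'k" where
  "rat_scale r x \<equiv> of_rat r * x"

interpretation rat_space: vector_space "rat_scale :: rat \<Rightarrow> 'k::field_char_0 \<Rightarrow> 'k"
  by unfold_locales (simp_all add: algebra_simps of_rat_add of_rat_mult)

class number_field = field_char_0 +
  assumes finite_over_rat: "\<exists>B. finite B \<and> (\<forall>x. \<exists>c. x = (\<Sum>b\<in>B. of_rat (c b) * b))"

lemma number_field_finite_span:
  "\<exists>B :: 'k::number_field set. finite B \<and> rat_space.span B = UNIV"
proof -
  obtain B :: "'k set" where B: "finite B" "\<And>x. \<exists>c. x = (\<Sum>b\<in>B. of_rat (c b) * b)"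
    using finite_over_rat by blast
  have "x \<in> rat_space.span B" for x
  proof -
    obtain c where c: "x = (\<Sum>b\<in>B. of_rat (c b) * b)"
      using B(2) by blast
    show ?thesis
      unfolding c by (intro rat_space.span_sum rat_space.span_scale rat_space.span_base)
  qed
  then show ?thesis
    using B(1) by blast
qed

instance rat :: number_field
proof
  show "\<exists>B. finite B \<and> (\<forall>x::rat. \<exists>c. x = (\<Sum>b\<in>B. of_rat (c b) * b))"
    by (rule exI[of _ "{1}"]) (auto intro!: exI[of _ "\<lambda>_. _"])
qed

definition field_degree :: "'k::number_field itself \<Rightarrow> nat" where
  "field_degree _ = rat_space.dim (UNIV :: 'k set)"

definition ring_of_integers :: "'k::number_field set" where
  "ring_of_integers = {x. algebraic_int x}"


section \<open>Archimedean places and completions\<close>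

definition embeddings :: "('k::number_field \<Rightarrow> complex) set" where
  "embeddings = {\<sigma>. \<sigma> 1 = 1 \<and> (\<forall>x y. \<sigma> (x + y) = \<sigma> x + \<sigma> y) \<and> (\<forall>x y. \<sigma> (x * y) = \<sigma> x * \<sigma> y)}"

text \<open>
  An Archimedean place is the set consisting of an embedding and its complex conjugate;
  it is a singleton exactly when the embedding is real.
\<close>

type_synonym 'k place = "('k \<Rightarrow> complex) set"

definition arch_places :: "'k::number_field place set" where
  "arch_places = (\<lambda>\<sigma>. {\<sigma>, cnj \<circ> \<sigma>}) ` embeddings"

text \<open>
  At a complex place the identification of the completion with the complex numbers is only
  determined up to conjugation, so one of the two embeddings is chosen once and for all.
  The absolute value of the place does not depend on this choice.
\<close>

definition place_emb :: "'k::number_field place \<Rightarrow> 'k \<Rightarrow> complex" where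
  "place_emb v = (SOME \<sigma>. \<sigma> \<in> v)"

text \<open>
  Since the complex numbers are complete, the completion of the field with respect to
  \<open>|place_emb v r|\<close> is the closure of the image of \<open>place_emb v\<close>.
\<close>

definition place_completion :: "'k::number_field place \<Rightarrow> complex set" where
  "place_completion v = closure (range (place_emb v))"

lemma place_emb_in_embeddings:
  assumes "v \<in> arch_places"
  shows "place_emb v \<in> embeddings"
proof -
  obtain \<sigma> where \<sigma>: "\<sigma> \<in> embeddings" "v = {\<sigma>, cnj \<circ> \<sigma>}"
    using assms unfolding arch_places_def by blast
  have "place_emb v \<in> v"
    unfolding place_emb_def using \<sigma>(2) by (intro someI[of "\<lambda>x. x \<in> v" \<sigma>]) simp
  moreover have "cnj \<circ> \<sigma> \<in> embeddings"
    using \<sigma>(1) by (simp add: embeddings_def)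
  ultimately show ?thesis
    using \<sigma> by auto
qed

lemma embedding_of_rat:
  fixes \<sigma> :: "'k::number_field \<Rightarrow> complex"
  assumes "\<sigma> \<in> embeddings"
  shows "\<sigma> (of_rat r) = of_rat r"
proof -
  have add: "\<sigma> (x + y) = \<sigma> x + \<sigma> y" and mult: "\<sigma> (x * y) = \<sigma> x * \<sigma> y" and one: "\<sigma> 1 = 1" for x y
    using assms by (auto simp: embeddings_def)
  have zero: "\<sigma> 0 = 0"
    using add[of 0 0] by simp
  have neg: "\<sigma> (- x) = - \<sigma> x" for x
    using add[of x "- x"] zero by (simp add: eq_neg_iff_add_eq_0 add.commute)
  have nat: "\<sigma> (of_nat n) = of_nat n" for n
    by (induction n) (simp_all add: zero one add)
  have int: "\<sigma> (of_int k) = of_int k" for k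
    by (cases k rule: int_cases2) (simp_all add: nat neg)
  obtain a b where r: "r = of_int a / of_int b" "b \<noteq> 0"
    by (metis Fract_of_int_quotient Rat_cases less_irrefl)
  have "(of_rat r :: 'k) * of_int b = of_int a"
    using r by (simp add: of_rat_divide)
  then have "\<sigma> (of_rat r) * \<sigma> (of_int b) = \<sigma> (of_int a)"
    by (simp only: mult[symmetric])
  then have "\<sigma> (of_rat r) * of_int b = of_int a"
    by (simp only: int)
  then have "\<sigma> (of_rat r) = of_int a / of_int b"
    using r(2) by (simp add: field_simps)
  then show ?thesis
    by (simp add: r(1) of_rat_divide)
qed

lemma place_completion_cases:
  assumes "v \<in> arch_places"
  shows "place_completion v = \<real> \<or> place_completion v = UNIV"
proof -
  define \<sigma> where "\<sigma> = place_emb v"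
  have \<sigma>: "\<sigma> \<in> embeddings"
    unfolding \<sigma>_def using assms by (rule place_emb_in_embeddings)
  have add: "\<sigma> (x + y) = \<sigma> x + \<sigma> y" and mult: "\<sigma> (x * y) = \<sigma> x * \<sigma> y" for x y
    using \<sigma> by (auto simp: embeddings_def)
  define C where "C = place_completion v"
  have C: "C = closure (range \<sigma>)"
    by (simp add: C_def place_completion_def \<sigma>_def)
  have rats: "complex_of_real ` \<rat> \<subseteq> range \<sigma>"
  proof
    fix z assume "z \<in> complex_of_real ` \<rat>"
    then obtain r where "z = complex_of_real (of_rat r)"
      by (auto elim: Rats_cases)
    moreover have "complex_of_real (of_rat r) = of_rat r"
      by (cases r) (simp add: of_rat_rat)
    ultimately have "z = \<sigma> (of_rat r)"
      using embedding_of_rat[OF \<sigma>] by simp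
    then show "z \<in> range \<sigma>" by blast
  qed
  have "complex_of_real ` closure \<rat> \<subseteq> C"
    unfolding C using rats closure_subset[of "range \<sigma>"]
    by (intro image_closure_subset continuous_on_of_real continuous_on_id closed_closure)
      (rule subset_trans)
  then have reals: "\<real> \<subseteq> C"
    by (simp add: Rats_closure_real Reals_def)
  have closed_add: "x + y \<in> C" if xy: "x \<in> C" "y \<in> C" for x y
  proof -
    obtain f g where fg: "\<And>n. f n \<in> range \<sigma>" "f \<longlonglongrightarrow> x" "\<And>n. g n \<in> range \<sigma>" "g \<longlonglongrightarrow> y"
      using xy unfolding C closure_sequential by blast
    have "f n + g n \<in> range \<sigma>" for n
      using fg(1)[of n] fg(3)[of n] by (auto simp flip: add)
    then show ?thesis
      using tendsto_add[OF fg(2,4)] unfolding C closure_sequential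
      by (intro exI[of _ "\<lambda>n. f n + g n"]) simp
  qed
  have closed_mult: "x * y \<in> C" if xy: "x \<in> C" "y \<in> C" for x y
  proof -
    obtain f g where fg: "\<And>n. f n \<in> range \<sigma>" "f \<longlonglongrightarrow> x" "\<And>n. g n \<in> range \<sigma>" "g \<longlonglongrightarrow> y"
      using xy unfolding C closure_sequential by blast
    have "f n * g n \<in> range \<sigma>" for n
      using fg(1)[of n] fg(3)[of n] by (auto simp flip: mult)
    then show ?thesis
      using tendsto_mult[OF fg(2,4)] unfolding C closure_sequential
      by (intro exI[of _ "\<lambda>n. f n * g n"]) simp
  qed
  show ?thesis
  proof (cases "C \<subseteq> \<real>")
    case True
    then show ?thesis using reals C_def by blast
  next
    case False
    then obtain w where w: "w \<in> C" "w \<notin> \<real>" by blast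
    then have Im: "Im w \<noteq> 0"
      by (simp add: complex_is_Real_iff)
    have "z \<in> C" for z
    proof -
      have "z = of_real (Re z - Im z / Im w * Re w) + of_real (Im z / Im w) * w"
        using Im by (simp add: complex_eq_iff)
      moreover have "of_real (Re z - Im z / Im w * Re w) + of_real (Im z / Im w) * w \<in> C"
        using w(1) reals by (intro closed_add closed_mult) (auto intro: Reals_of_real)
      ultimately show ?thesis by simp
    qed
    then show ?thesis using C_def by blast
  qed
qed

definition real_places :: "'k::number_field place set \<Rightarrow> 'k place set" where
  "real_places T = {v \<in> T. place_completion v = \<real>}"

definition complex_places :: "'k::number_field place set \<Rightarrow> 'k place set" where
  "complex_places T = {v \<in> T. place_completion v = UNIV}"


section \<open>The product of the Archimedean completions\<close>

type_synonym 'k arch_vec = "'k place \<Rightarrow> complex"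

definition K_S :: "'k::number_field arch_vec set" where
  "K_S = (\<Pi>\<^sub>E v\<in>arch_places. place_completion v)"

definition add_S :: "'k::number_field arch_vec \<Rightarrow> 'k arch_vec \<Rightarrow> 'k arch_vec" where
  "add_S x y = (\<lambda>v\<in>arch_places. x v + y v)"

definition mult_S :: "'k::number_field arch_vec \<Rightarrow> 'k arch_vec \<Rightarrow> 'k arch_vec" where
  "mult_S x y = (\<lambda>v\<in>arch_places. x v * y v)"

definition norm_S :: "'k::number_field arch_vec \<Rightarrow> real" where
  "norm_S x = Max ((\<lambda>v. cmod (x v)) ` arch_places)"

definition iota_S :: "'k::number_field \<Rightarrow> 'k arch_vec" where
  "iota_S r = (\<lambda>v\<in>arch_places. place_emb v r)"


section \<open>Badly approximable vectors and rational subspaces\<close>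

definition badly_approximable :: "'k::number_field arch_vec \<Rightarrow> bool" where
  "badly_approximable x \<longleftrightarrow>
    (\<exists>c>0. \<forall>p\<in>ring_of_integers. \<forall>q\<in>ring_of_integers - {0}.
      norm_S (add_S (mult_S (iota_S q) x) (iota_S p)) > c * inverse (norm_S (iota_S q)))"

definition BA :: "'k::number_field arch_vec set" where
  "BA = {x \<in> K_S. badly_approximable x}"

definition subspace_through :: "'k::number_field arch_vec \<Rightarrow> 'k place set \<Rightarrow> 'k arch_vec set" where
  "subspace_through x T = {y \<in> K_S. \<forall>v\<in>T. y v = x v}"

definition rational_subspaces :: "'k::number_field arch_vec set set" where
  "rational_subspaces = {subspace_through x T | x T.
     x \<in> range iota_S \<and> T \<subseteq> arch_places \<and>
     real (card (real_places T) + 2 * card (complex_places T)) > real (field_degree TYPE('k)) / 2}"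

end

theory Submission
  imports Defs "HOL-Library.Function_Algebras" "Jordan_Normal_Form.Char_Poly"
begin

text \<open>
  Let \<open>y\<close> agree at the places of \<open>T\<close> with \<open>r \<in> K\<close>, and let \<open>N\<close> be a denominator of \<open>r\<close>. The pair
  \<open>(N q, - N r q)\<close> has error zero at every place in \<open>T\<close>, and error proportional to \<open>|q|\<^sub>v\<close>
  elsewhere. Since \<open>T\<close> carries more than half of the \<open>d\<close> embeddings, the pigeonhole principle
  provides integers \<open>q \<noteq> 0\<close> of norm at most \<open>Q\<close> that are at most \<open>\<delta> / Q\<close> at all places outside \<open>T\<close>,
  with \<open>\<delta>\<close> arbitrarily small. It suffices to work in an order of \<open>K\<close> instead of the full ring of
  integers.
\<close>

section \<open>Orders in number fields\<close>

text \<open>The Z-module generated by a finite \<open>B\<close>, with coefficients indexed by the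
  generators themselves. If products of generators stay inside, it is a ring, possibly without 1. An
  infinite \<open>B\<close> gives \<open>{0}\<close>, the default value of the sum.\<close>

definition int_span :: "'a::comm_ring_1 set \<Rightarrow> 'a set" where
  "int_span B = range (\<lambda>u. \<Sum>b\<in>B. of_int (u b) * b)"

section \<open>Closure properties of integer spans\<close>

lemma int_span_sum_base: "(\<Sum>b\<in>B. of_int (u b) * b) \<in> int_span B"
  by (auto simp: int_span_def)

lemma int_span_base: "finite B \<Longrightarrow> b \<in> B \<Longrightarrow> b \<in> int_span B"
  using int_span_sum_base[of "\<lambda>c. if c = b then 1 else 0" B]
  by (simp add: if_distrib[of of_int] if_distrib[of "\<lambda>x. x * _"] cong: if_cong)

lemma int_span_add: "x \<in> int_span B \<Longrightarrow> y \<in> int_span B \<Longrightarrow> x + y \<in> int_span B"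
proof -
  assume "x \<in> int_span B" "y \<in> int_span B"
  then obtain u w where "x = (\<Sum>b\<in>B. of_int (u b) * b)" "y = (\<Sum>b\<in>B. of_int (w b) * b)"
    unfolding int_span_def by blast
  then have "x + y = (\<Sum>b\<in>B. of_int (u b + w b) * b)"
    by (simp add: distrib_right sum.distrib)
  then show ?thesis using int_span_sum_base[of "\<lambda>b. u b + w b" B] by (simp only:)
qed

lemma int_span_scale: "x \<in> int_span B \<Longrightarrow> of_int k * x \<in> int_span B"
proof -
  assume "x \<in> int_span B"
  then obtain u where "x = (\<Sum>b\<in>B. of_int (u b) * b)"
    unfolding int_span_def by blast
  then have "of_int k * x = (\<Sum>b\<in>B. of_int (k * u b) * b)"
    by (simp add: sum_distrib_left mult.assoc)
  then show ?thesis by (metis int_span_sum_base)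
qed

lemma int_span_zero: "0 \<in> int_span B"
  using int_span_sum_base[of "\<lambda>_. 0" B] by simp

lemma int_span_minus: "x \<in> int_span B \<Longrightarrow> - x \<in> int_span B"
  using int_span_scale[of x B "-1"] by simp

lemma int_span_sum: "(\<And>i. i \<in> A \<Longrightarrow> f i \<in> int_span B) \<Longrightarrow> sum f A \<in> int_span B"
  by (induction A rule: infinite_finite_induct) (auto intro: int_span_zero int_span_add)

text \<open>By bilinearity only the products of generators have to be checked.\<close>

lemma int_span_mult:
  assumes mult: "\<And>b c. b \<in> B \<Longrightarrow> c \<in> B \<Longrightarrow> b * c \<in> int_span B"
    and "x \<in> int_span B" "y \<in> int_span B"
  shows "x * y \<in> int_span B"
proof -
  obtain u w where "x = (\<Sum>b\<in>B. of_int (u b) * b)" "y = (\<Sum>c\<in>B. of_int (w c) * c)"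
    using assms(2,3) unfolding int_span_def by blast
  then have "x * y = (\<Sum>b\<in>B. \<Sum>c\<in>B. of_int (u b * w c) * (b * c))"
    by (simp add: sum_product mult_ac)
  also have "\<dots> \<in> int_span B"
    by (intro int_span_sum int_span_scale mult)
  finally show ?thesis .
qed

text \<open>The determinant trick: \<open>x\<close> is an eigenvalue of the integer matrix of multiplication by \<open>x\<close>.\<close>

lemma algebraic_int_if_mult_int_span:
  fixes x :: "'a::field_char_0"
  assumes fin: "finite B" and nz: "b0 \<in> B" "b0 \<noteq> 0"
    and closed: "\<And>b. b \<in> B \<Longrightarrow> x * b \<in> int_span B"
  shows "algebraic_int x"
proof -
  obtain bs where bs: "set bs = B" "distinct bs"
    using finite_distinct_list[OF fin] by blast
  define n where "n = length bs"
  have "\<exists>u. x * b = (\<Sum>c\<in>B. of_int (u c) * c)" if "b \<in> B" for b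
    using closed[OF that] by (auto simp: int_span_def)
  then obtain u where u: "\<And>b. b \<in> B \<Longrightarrow> x * b = (\<Sum>c\<in>B. of_int (u b c) * c)"
    by metis
  \<comment> \<open>Row \<open>i\<close> holds integer coordinates of \<open>x * bs ! i\<close>, so
    the vector \<open>w\<close> of generators is an eigenvector of \<open>A\<close> with eigenvalue
    \<open>x\<close>; the generator \<open>b0\<close> keeps it nonzero.\<close>
  define A where "A = mat n n (\<lambda>(i, j). u (bs ! i) (bs ! j))"
  define w where "w = vec_of_list bs"
  have A: "A \<in> carrier_mat n n" "map_mat of_int A \<in> carrier_mat n n"
    by (simp_all add: A_def)
  have w: "w \<in> carrier_vec n"
    by (simp add: w_def n_def carrier_vecI)
  have sum_B: "(\<Sum>c\<in>B. f c) = (\<Sum>j<n. f (bs ! j))" for f :: "'a \<Rightarrow> 'a"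
    using sum.reindex_bij_betw[OF bij_betw_nth[OF bs(2) refl refl], of f] bs by (simp add: n_def)
  have "map_mat of_int A *\<^sub>v w = x \<cdot>\<^sub>v w"
  proof (rule eq_vecI)
    fix i assume "i < dim_vec (x \<cdot>\<^sub>v w)"
    then have i: "i < n" using w by simp
    then have "bs ! i \<in> B" using bs n_def by auto
    have "(map_mat of_int A *\<^sub>v w) $ i = (\<Sum>j<n. of_int (u (bs ! i) (bs ! j)) * bs ! j)"
      using i A w by (simp add: scalar_prod_def A_def w_def n_def vec_of_list_index atLeast0LessThan)
    also have "\<dots> = x * bs ! i"
      using u[OF \<open>bs ! i \<in> B\<close>] by (simp add: sum_B)
    finally show "(map_mat of_int A *\<^sub>v w) $ i = (x \<cdot>\<^sub>v w) $ i"
      using i by (simp add: w_def n_def vec_of_list_index)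
  qed (use A w in auto)
  moreover have "w \<noteq> 0\<^sub>v n"
  proof -
    obtain i where i: "i < n" "bs ! i = b0"
      using nz(1) bs by (metis in_set_conv_nth n_def)
    have "w $ i \<noteq> 0" using i nz(2) by (simp add: w_def vec_of_list_index)
    then show ?thesis using i by auto
  qed
  ultimately have "eigenvalue (map_mat of_int A) x"
    using A w unfolding eigenvalue_def eigenvector_def by auto
  then have "poly (char_poly (map_mat of_int A)) x = 0"
    using eigenvalue_root_char_poly[OF A(2)] by blast
  then have "poly (map_poly of_int (char_poly A)) x = 0"
    by (simp add: of_int_hom.char_poly_hom[OF A(1)])
  \<comment> \<open>The characteristic polynomial is computed over the integers and is monic, so its
    root \<open>x\<close> is an algebraic integer.\<close>
  moreover have "lead_coeff (char_poly A) = 1"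
    using degree_monic_char_poly[OF A(1)] by simp
  ultimately show ?thesis
    unfolding algebraic_int_altdef_ipoly by blast
qed

section \<open>Clearing denominators\<close>

lemma common_denominator:
  fixes A :: "rat set"
  assumes "finite A"
  shows "\<exists>n::int. n > 0 \<and> (\<forall>r\<in>A. of_int n * r \<in> \<int>)"
  using assms
proof induction
  case empty
  then show ?case by (auto intro: exI[of _ 1])
next
  case (insert r A)
  then obtain n :: int where n: "n > 0" "\<And>r. r \<in> A \<Longrightarrow> of_int n * r \<in> \<int>" by blast
  obtain a b where r: "r = Rat.Fract a b" "b > 0" by (cases r)
  have "of_int b * r = of_int a"
    using r by (simp add: Fract_of_int_quotient)
  then have *: "of_int (n * b) * s = of_int b * (of_int n * s)"
    "of_int (n * b) * r = of_int (n * a)" for s :: rat by (simp_all add: mult_ac)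
  show ?case
  proof (intro exI[of _ "n * b"] conjI ballI)
    show "n * b > 0" using n r by simp
  next
    fix s assume "s \<in> insert r A"
    then consider "s = r" | "s \<in> A" by blast
    then show "of_int (n * b) * s \<in> \<int>"
    proof cases
      case 1
      then show ?thesis using *(2) by (metis Ints_of_int)
    next
      case 2
      then show ?thesis unfolding *(1) by (intro Ints_mult Ints_of_int n(2))
    qed
  qed
qed

text \<open>Only finitely many rational coordinates occur, so one integer clears them all. This
  serves both for the structure constants of a basis and for the denominator of a given field
  element.\<close>

lemma rat_combination_denominator:
  fixes B :: "'a::field_char_0 set"
  assumes "finite B" "x \<in> rat_space.span B"
  shows "\<exists>n::int. n > 0 \<and> of_int n * x \<in> int_span B"
proof -
  obtain c where c: "x = (\<Sum>b\<in>B. of_rat (c b) * b)"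
    using assms(2) unfolding rat_space.span_finite[OF assms(1)] by blast
  obtain n :: int where n: "n > 0" "\<And>b. b \<in> B \<Longrightarrow> of_int n * c b \<in> \<int>"
    using common_denominator[of "c ` B"] assms(1) by auto
  have "\<exists>k. of_int n * c b = of_int k" if "b \<in> B" for b
    using n(2)[OF that] by (auto elim: Ints_cases)
  then obtain k where k: "\<And>b. b \<in> B \<Longrightarrow> of_int n * c b = of_int (k b)"
    by metis
  have "of_int n * of_rat (c b) = (of_int (k b) :: 'a)" if "b \<in> B" for b
    using arg_cong[OF k[OF that], of "of_rat :: rat \<Rightarrow> 'a"] by (simp add: of_rat_mult)
  then have "of_int n * x = (\<Sum>b\<in>B. of_int (k b) * b)"
    unfolding c sum_distrib_left by (intro sum.cong) (simp_all flip: mult.assoc)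
  then show ?thesis
    using n(1) int_span_sum_base by metis
qed

text \<open>
  Multiplying a rational basis by a common denominator of its structure constants makes
  the structure constants integral.
\<close>

lemma integral_basis_exists:
  obtains B :: "'k::number_field set"
  where "finite B" "rat_space.independent B" "card B = field_degree TYPE('k)"
    "\<And>x y. x \<in> int_span B \<Longrightarrow> y \<in> int_span B \<Longrightarrow> x * y \<in> int_span B"
    "int_span B \<subseteq> ring_of_integers"
    "rat_space.span B = UNIV"
    "\<And>x. \<exists>n::int. n > 0 \<and> of_int n * x \<in> int_span B"
proof -
  obtain F :: "'k set" where F: "finite F" "rat_space.span F = UNIV"
    using number_field_finite_span by blast
  obtain C :: "'k set" where C': "rat_space.independent C" "UNIV \<subseteq> rat_space.span C"
    "card C = rat_space.dim (UNIV :: 'k set)"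
    by (rule rat_space.basis_exists[of "UNIV :: 'k set"])
  then have C: "rat_space.independent C" "rat_space.span C = UNIV"
    "card C = rat_space.dim (UNIV :: 'k set)" by blast+
  have finC: "finite C"
    using rat_space.independent_span_bound[OF F(1) C(1)] F(2) by simp
  define P where "P = (\<lambda>(b, c). b * c) ` (C \<times> C)"
  have "\<forall>p\<in>P. \<exists>n::int. n > 0 \<and> of_int n * p \<in> int_span C"
    using rat_combination_denominator[OF finC] C(2) by blast
  then obtain m :: "'k \<Rightarrow> int" where m: "\<And>p. p \<in> P \<Longrightarrow> m p > 0 \<and> of_int (m p) * p \<in> int_span C"
    by metis
  have finP: "finite P" using finC by (simp add: P_def)
  \<comment> \<open>A single multiplier for all pairwise products of \<open>C\<close>: each
    \<open>m p\<close> divides it.\<close>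
  define D where "D = (\<Prod>p\<in>P. m p)"
  have D0: "D > 0" unfolding D_def using m by (intro prod_pos) auto
  have D: "of_int D * p \<in> int_span C" if "p \<in> P" for p
  proof -
    have "D = (\<Prod>p\<in>P - {p}. m p) * m p"
      unfolding D_def using finP that by (simp add: prod.remove[of P p])
    then show ?thesis using m[OF that] int_span_scale
      by (metis (no_types, lifting) mult.assoc of_int_mult)
  qed
  define B where "B = (\<lambda>c. of_int D * c) ` C"
  have inj: "inj_on (\<lambda>c. of_int D * c) C" using D0 by (auto simp: inj_on_def)
  have finB: "finite B" using finC by (simp add: B_def)
  have sumB: "(\<Sum>b\<in>B. f b) = (\<Sum>c\<in>C. f (of_int D * c))" for f :: "'k \<Rightarrow> 'k"
    unfolding B_def using inj by (simp add: sum.reindex)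
  have scale: "of_int D * x \<in> int_span B" if x: "x \<in> int_span C" for x
  proof -
    obtain u where u: "x = (\<Sum>c\<in>C. of_int (u c) * c)"
      using x unfolding int_span_def by blast
    have "of_int D * x = (\<Sum>b\<in>B. of_int (u (b / of_int D)) * b)"
      unfolding sumB u sum_distrib_left using D0 by (intro sum.cong) auto
    then show ?thesis using int_span_sum_base by metis
  qed
  have ind: "rat_space.independent B"
    unfolding rat_space.dependent_finite[OF finB]
  proof safe
    fix u :: "'k \<Rightarrow> rat" and b assume *: "(\<Sum>v\<in>B. of_rat (u v) * v) = 0" "b \<in> B" "u b \<noteq> 0"
    have "of_int D * (\<Sum>c\<in>C. of_rat (u (of_int D * c)) * c) = 0"
      using *(1) unfolding sumB sum_distrib_left by (simp add: mult_ac)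
    then have "(\<Sum>c\<in>C. of_rat (u (of_int D * c)) * c) = 0" using D0 by simp
    then have "\<forall>c\<in>C. u (of_int D * c) = 0"
      by (intro ballI rat_space.independentD[OF C(1) finC order_refl])
    then show False using * by (auto simp: B_def)
  qed
  have mult_base: "b * c \<in> int_span B" if bc: "b \<in> B" "c \<in> B" for b c
  proof -
    obtain b' c' where "b = of_int D * b'" "c = of_int D * c'" "b' \<in> C" "c' \<in> C"
      using bc by (auto simp: B_def)
    \<comment> \<open>One factor \<open>D\<close> moves \<open>b' * c'\<close> into
      \<open>int_span C\<close>, the other moves the result on into
      \<open>int_span B\<close>.\<close>
    moreover from this have "of_int D * (of_int D * (b' * c')) \<in> int_span B"
      by (intro scale D) (auto simp: P_def)
    ultimately show ?thesis by (simp add: mult_ac)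
  qed
  have mult: "x * y \<in> int_span B" if "x \<in> int_span B" "y \<in> int_span B" for x y
    using int_span_mult[OF mult_base that] by blast
  have nz: "b \<noteq> 0" if "b \<in> B" for b
    using ind that rat_space.dependent_zero by blast
  have span: "rat_space.span B = UNIV"
  proof -
    have "c \<in> rat_space.span B" if "c \<in> C" for c
    proof -
      have "c = of_rat (1 / of_int D) * (of_int D * c)"
        using D0 by (simp add: of_rat_divide)
      then show ?thesis using that
        by (metis B_def image_eqI rat_space.span_base rat_space.span_scale)
    qed
    then have "rat_space.span C \<subseteq> rat_space.span B"
      by (intro rat_space.span_minimal rat_space.subspace_span) blast
    then show ?thesis using C(2) by blast
  qed
  \<comment> \<open>The determinant trick requires a nonzero generator; an empty basis could not
    span 1.\<close>
  have "B \<noteq> {}"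
  proof
    assume "B = {}"
    then have "(1 :: 'k) \<in> rat_space.span {}" using span by simp
    then show False by (simp add: rat_space.span_empty)
  qed
  then obtain b0 where b0: "b0 \<in> B" by blast
  have "int_span B \<subseteq> ring_of_integers"
    unfolding ring_of_integers_def
    using algebraic_int_if_mult_int_span[OF finB b0 nz[OF b0]] mult int_span_base[OF finB] by blast
  moreover have "card B = field_degree TYPE('k)"
    unfolding field_degree_def C(3)[symmetric] B_def using inj by (rule card_image)
  ultimately show ?thesis
    using that[of B] finB ind mult span rat_combination_denominator[OF finB] by simp
qed

section \<open>Embeddings\<close>

lemma embeddingD:
  assumes "\<sigma> \<in> embeddings"
  shows "\<sigma> 1 = 1" "\<sigma> (x + y) = \<sigma> x + \<sigma> y" "\<sigma> (x * y) = \<sigma> x * \<sigma> y"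
  using assms by (auto simp: embeddings_def)

lemma embedding_zero: "\<sigma> \<in> embeddings \<Longrightarrow> \<sigma> 0 = 0"
  using embeddingD(2)[of \<sigma> 0 0] by simp

lemma embedding_minus: "\<sigma> \<in> embeddings \<Longrightarrow> \<sigma> (- x) = - \<sigma> x"
  using embeddingD(2)[of \<sigma> x "- x"] embedding_zero[of \<sigma>] by (simp add: eq_neg_iff_add_eq_0 add.commute)

lemma embedding_of_int:
  assumes "\<sigma> \<in> embeddings"
  shows "\<sigma> (of_int k) = of_int k"
  using embedding_of_rat[OF assms, of "of_int k"] by (simp only: of_rat_of_int_eq)

lemma embedding_sum:
  assumes \<sigma>: "\<sigma> \<in> embeddings"
  shows "\<sigma> (sum f A) = (\<Sum>i\<in>A. \<sigma> (f i))"
  by (induction A rule: infinite_finite_induct)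
    (simp_all add: embedding_zero[OF \<sigma>] embeddingD[OF \<sigma>])

lemma embedding_nonzero:
  assumes "\<sigma> \<in> embeddings" "x \<noteq> 0"
  shows "\<sigma> x \<noteq> 0"
  using embeddingD(3)[OF assms(1), of x "inverse x"] embeddingD(1)[OF assms(1)] assms(2) by auto

lemma cnj_embedding: "\<sigma> \<in> embeddings \<Longrightarrow> cnj \<circ> \<sigma> \<in> embeddings"
  by (simp add: embeddings_def)

lemma cnj_cnj_comp: "cnj \<circ> (cnj \<circ> \<sigma>) = \<sigma>"
  by (simp add: fun_eq_iff)

text \<open>Artin's argument for the independence of characters: from the relation at
  \<open>y * x\<close>, subtract \<open>\<tau> y\<close> times the relation at \<open>x\<close>. The
  term of \<open>\<tau>\<close> cancels, and in the shorter relation \<open>c \<sigma>\<close> is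
  multiplied by \<open>\<sigma> y - \<tau> y\<close>, which is nonzero for a suitable
  \<open>y\<close>.\<close>

lemma embeddings_independent:
  fixes F :: "('k::number_field \<Rightarrow> complex) set"
  assumes "finite F" "F \<subseteq> embeddings" "\<And>x. (\<Sum>\<sigma>\<in>F. c \<sigma> * \<sigma> x) = 0"
  shows "\<forall>\<sigma>\<in>F. c \<sigma> = 0"
  using assms
proof (induction F arbitrary: c)
  case (insert \<tau> F)
  have \<tau>: "\<tau> \<in> embeddings" using insert.prems by blast
  have F0: "c \<sigma> = 0" if \<sigma>: "\<sigma> \<in> F" for \<sigma>
  proof -
    obtain y where y: "\<sigma> y \<noteq> \<tau> y"
      using \<sigma> insert.hyps(2) by (metis ext)
    have "\<forall>\<sigma>\<in>F. c \<sigma> * (\<sigma> y - \<tau> y) = 0"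
    proof (rule insert.IH)
      fix x
      have "c \<tau> * \<tau> (y * x) + (\<Sum>\<sigma>\<in>F. c \<sigma> * \<sigma> (y * x)) = 0"
        and 2: "c \<tau> * \<tau> x + (\<Sum>\<sigma>\<in>F. c \<sigma> * \<sigma> x) = 0"
        using insert.prems(2)[of "y * x"] insert.prems(2)[of x] insert.hyps by simp_all
      moreover have "(\<Sum>\<sigma>\<in>F. c \<sigma> * \<sigma> (y * x)) = (\<Sum>\<sigma>\<in>F. c \<sigma> * (\<sigma> y * \<sigma> x))"
        using insert.prems(1) by (intro sum.cong) (auto simp: embeddingD(3)[OF subsetD])
      ultimately have 1: "c \<tau> * \<tau> y * \<tau> x + (\<Sum>\<sigma>\<in>F. c \<sigma> * (\<sigma> y * \<sigma> x)) = 0"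
        using embeddingD(3)[OF \<tau>] by (simp add: mult_ac)
      have "(\<Sum>\<sigma>\<in>F. c \<sigma> * (\<sigma> y - \<tau> y) * \<sigma> x)
        = (\<Sum>\<sigma>\<in>F. c \<sigma> * (\<sigma> y * \<sigma> x)) - \<tau> y * (\<Sum>\<sigma>\<in>F. c \<sigma> * \<sigma> x)"
        by (simp add: sum_distrib_left sum_subtractf algebra_simps)
      also have "\<dots> = - (c \<tau> * \<tau> y * \<tau> x) - \<tau> y * (- (c \<tau> * \<tau> x))"
        using 1 2 by (simp only: add_eq_0_iff)
      also have "\<dots> = 0" by simp
      finally show "(\<Sum>\<sigma>\<in>F. c \<sigma> * (\<sigma> y - \<tau> y) * \<sigma> x) = 0" .
    qed (use insert.prems in auto)
    then show ?thesis using \<sigma> y by auto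
  qed
  then have "c \<tau> * \<tau> 1 = 0"
    using insert.prems(2)[of 1] insert.hyps by simp
  then show ?case using F0 embeddingD(1)[OF \<tau>] by simp
qed simp

text \<open>The embeddings lie in the complex span of the coordinate functions of a rational basis.\<close>

lemma card_embeddings_le:
  "finite (embeddings :: ('k::number_field \<Rightarrow> complex) set) \<and>
   card (embeddings :: ('k \<Rightarrow> complex) set) \<le> field_degree TYPE('k)"
proof -
  obtain B :: "'k set" where B: "finite B" "rat_space.independent B"
    "card B = field_degree TYPE('k)" "rat_space.span B = UNIV"
    using integral_basis_exists by metis
  have "\<forall>x. \<exists>u. x = (\<Sum>b\<in>B. of_rat (u b) * b)"
    using B(4) unfolding rat_space.span_finite[OF B(1)] by blast
  then have "\<exists>co. \<forall>x. x = (\<Sum>b\<in>B. of_rat (co x b) * b)" by (rule choice)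
  then obtain co where co: "\<forall>x. x = (\<Sum>b\<in>B. of_rat (co x b) * b)" by (elim exE)
  define cf where "cf b x = (of_rat (co x b) :: complex)" for b x
  \<comment> \<open>Pointwise scaling makes the functions from the field to the complex numbers a
    complex vector space.\<close>
  define sc where "sc a f = (\<lambda>x. a * f x)" for a :: complex and f :: "'k \<Rightarrow> complex"
  interpret fs: vector_space sc
    by unfold_locales (auto simp: sc_def fun_eq_iff algebra_simps)
  have sum_fun: "(\<Sum>i\<in>A. f i) x = (\<Sum>i\<in>A. f i x)" for A :: "'i set" and f :: "'i \<Rightarrow> 'k \<Rightarrow> complex" and x
    by (induction A rule: infinite_finite_induct) auto
  have "embeddings \<subseteq> fs.span (cf ` B)"
  proof
    fix \<sigma> :: "'k \<Rightarrow> complex" assume \<sigma>: "\<sigma> \<in> embeddings"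
    \<comment> \<open>Embeddings are Q-linear, so the value \<open>\<sigma> b\<close> is the
      coefficient of the coordinate function \<open>cf b\<close>.\<close>
    have "\<sigma> x = (\<Sum>b\<in>B. sc (\<sigma> b) (cf b)) x" for x
    proof -
      have "\<sigma> x = \<sigma> (\<Sum>b\<in>B. of_rat (co x b) * b)" by (rule arg_cong[OF spec[OF co]])
      also have "\<dots> = (\<Sum>b\<in>B. sc (\<sigma> b) (cf b)) x"
        by (simp add: sum_fun embedding_sum[OF \<sigma>] embeddingD[OF \<sigma>] embedding_of_rat[OF \<sigma>]
            sc_def cf_def mult_ac)
      finally show ?thesis .
    qed
    then have "\<sigma> = (\<Sum>b\<in>B. sc (\<sigma> b) (cf b))" by blast
    also have "\<dots> \<in> fs.span (cf ` B)"
      by (intro fs.span_sum fs.span_scale fs.span_base) auto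
    finally show "\<sigma> \<in> fs.span (cf ` B)" .
  qed
  moreover have "fs.independent embeddings"
    unfolding fs.independent_explicit_finite_subsets
  proof (intro allI impI)
    fix F :: "('k \<Rightarrow> complex) set" and c
    assume F: "F \<subseteq> embeddings" "finite F" "(\<Sum>\<sigma>\<in>F. sc (c \<sigma>) \<sigma>) = 0"
    have "(\<Sum>\<sigma>\<in>F. c \<sigma> * \<sigma> x) = 0" for x
      using fun_cong[OF F(3), of x] by (simp add: sum_fun sc_def)
    then show "\<forall>\<sigma>\<in>F. c \<sigma> = 0" using embeddings_independent F by blast
  qed
  ultimately have "finite (embeddings :: ('k \<Rightarrow> complex) set) \<and>
    card (embeddings :: ('k \<Rightarrow> complex) set) \<le> card (cf ` B)"
    using fs.independent_span_bound[of "cf ` B"] B(1) by blast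
  then show ?thesis using card_image_le[OF B(1), of cf] B(3) by linarith
qed

section \<open>Small values of linear forms\<close>

text \<open>
  Pigeonhole: the box \<open>{0..Q}\<^sup>d\<close> has \<open>(Q + 1)\<^sup>d\<close> points, and cells of side \<open>\<delta> / Q\<close>
  cut the values of the \<open>m\<close> forms into \<open>O (Q\<^sup>2\<^sup>m)\<close> classes.
\<close>

lemma small_linear_forms:
  fixes a :: "'e \<Rightarrow> 'i \<Rightarrow> real"
  assumes finI: "finite I" and finE: "finite E" and card: "2 * card E < card I" and \<delta>: "\<delta> > 0"
  obtains n :: "'i \<Rightarrow> int" and Q :: real
  where "Q > 0" "\<exists>i\<in>I. n i \<noteq> 0" "\<And>i. i \<in> I \<Longrightarrow> \<bar>n i\<bar> \<le> Q"
    "\<And>e. e \<in> E \<Longrightarrow> \<bar>\<Sum>i\<in>I. n i * a e i\<bar> \<le> \<delta> / Q"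
proof -
  define A where "A = (\<Sum>e\<in>E. \<Sum>i\<in>I. \<bar>a e i\<bar>)"
  have A0: "A \<ge> 0" unfolding A_def by (intro sum_nonneg) auto
  have A: "(\<Sum>i\<in>I. \<bar>a e i\<bar>) \<le> A" if "e \<in> E" for e
    unfolding A_def by (rule member_le_sum[OF that _ finE]) (auto intro: sum_nonneg)
  obtain R :: nat where R: "A / \<delta> \<le> R" using real_arch_simple by blast
  define m where "m = card E"
  \<comment> \<open>With this choice the bound \<open>((2 * R + 1) * Q^2) ^ m\<close> for the number
    of cells is exactly \<open>Q ^ (2 * m + 1)\<close>. The box has at least
    \<open>(Q + 1) ^ (2 * m + 1)\<close> points, because \<open>2 * m < card I\<close>.\<close>
  define Q where "Q = (2 * R + 1) ^ m"
  \<comment> \<open>On the box a form is at most \<open>Q * A \<le> Q * R * \<delta>\<close>, which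
    is \<open>R * Q^2\<close> cells of side \<open>\<delta> / Q\<close>.\<close>
  define k where "k = int (R * Q\<^sup>2)"
  have Q1: "Q \<ge> 1" unfolding Q_def by simp
  define s where "s = \<delta> / Q"
  have s0: "s > 0" using \<delta> Q1 by (simp add: s_def)
  define L where "L n e = (\<Sum>i\<in>I. real_of_int (n i) * a e i)" for n e
  define X where "X = PiE I (\<lambda>_. {0..int Q})"
  define f where "f n = (\<lambda>e\<in>E. \<lfloor>L n e / s\<rfloor>)" for n
  have "f n \<in> PiE E (\<lambda>_. {-k..k})" if n: "n \<in> X" for n
  proof -
    have "\<lfloor>L n e / s\<rfloor> \<in> {-k..k}" if e: "e \<in> E" for e
    proof -
      have "\<bar>L n e\<bar> \<le> (\<Sum>i\<in>I. \<bar>real_of_int (n i) * a e i\<bar>)"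
        unfolding L_def by (rule sum_abs)
      also have "\<dots> \<le> (\<Sum>i\<in>I. Q * \<bar>a e i\<bar>)"
      proof (intro sum_mono)
        fix i assume "i \<in> I"
        then have "0 \<le> n i" "n i \<le> int Q" using n by (auto simp: X_def)
        then have "\<bar>real_of_int (n i)\<bar> \<le> Q" by linarith
        then show "\<bar>real_of_int (n i) * a e i\<bar> \<le> Q * \<bar>a e i\<bar>"
          by (simp add: abs_mult mult_right_mono)
      qed
      also have "\<dots> = Q * (\<Sum>i\<in>I. \<bar>a e i\<bar>)" by (simp add: sum_distrib_left)
      also have "\<dots> \<le> Q * A" using A[OF e] by (simp add: mult_left_mono)
      also have "\<dots> \<le> Q * (R * \<delta>)"
        using R \<delta> by (intro mult_left_mono) (simp_all add: field_simps)
      also have "\<dots> = of_int k * s"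
        using Q1 by (simp add: k_def s_def power2_eq_square)
      finally have "\<bar>L n e / s\<bar> \<le> of_int k"
        using s0 by (simp add: pos_divide_le_eq)
      then have "- k \<le> \<lfloor>L n e / s\<rfloor>" "\<lfloor>L n e / s\<rfloor> \<le> k" by linarith+
      then show ?thesis by simp
    qed
    then show ?thesis by (auto simp: f_def)
  qed
  then have sub: "f ` X \<subseteq> PiE E (\<lambda>_. {-k..k})" by blast
  have "card (f ` X) \<le> card (PiE E (\<lambda>_. {-k..k}))"
    by (rule card_mono[OF _ sub]) (simp add: finite_PiE finE)
  also have "\<dots> = (2 * (R * Q\<^sup>2) + 1) ^ m"
    by (simp add: card_PiE finE m_def k_def nat_add_distrib nat_mult_distrib nat_power_eq)
  also have "\<dots> \<le> ((2 * R + 1) * Q\<^sup>2) ^ m"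
    using Q1 by (intro power_mono) (simp_all add: algebra_simps)
  also have "\<dots> = (2 * R + 1) ^ m * Q ^ (2 * m)"
    by (simp only: power_mult_distrib power_mult)
  also have "\<dots> = Q ^ (2 * m + 1)"
    unfolding Q_def[symmetric] power_add power_one_right by (rule mult.commute)
  also have "\<dots> < (Q + 1) ^ (2 * m + 1)" by (rule power_strict_mono) auto
  also have "\<dots> \<le> (Q + 1) ^ card I"
    using card by (intro power_increasing) (auto simp: m_def)
  also have "\<dots> = card X"
    by (simp add: X_def card_PiE finI nat_add_distrib)
  finally have "\<not> inj_on f X"
    using card_image[of f X] by linarith
  then obtain n n' where n: "n \<in> X" "n' \<in> X" "n \<noteq> n'" "f n = f n'"
    unfolding inj_on_def by blast
  \<comment> \<open>Both functions are \<open>undefined\<close> outside \<open>I\<close>, so they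
    must differ at an index in \<open>I\<close>.\<close>
  have "n \<in> extensional I" "n' \<in> extensional I" using n by (auto simp: X_def PiE_def)
  then have "\<exists>i\<in>I. n i \<noteq> n' i" using n(3) extensionalityI by blast
  then have "\<exists>i\<in>I. n i - n' i \<noteq> 0" by simp
  moreover have "\<bar>n i - n' i\<bar> \<le> real Q" if i: "i \<in> I" for i
  proof -
    have "0 \<le> n i" "n i \<le> int Q" "0 \<le> n' i" "n' i \<le> int Q"
      using n(1,2) i by (auto simp: X_def)
    then show ?thesis by linarith
  qed
  moreover have "\<bar>\<Sum>i\<in>I. (n i - n' i) * a e i\<bar> \<le> \<delta> / Q" if e: "e \<in> E" for e
  proof -
    have "\<lfloor>L n e / s\<rfloor> = \<lfloor>L n' e / s\<rfloor>"
      using fun_cong[OF n(4), of e] e by (simp add: f_def)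
    then have "\<bar>L n e / s - L n' e / s\<bar> \<le> 1" by linarith
    then have "\<bar>L n e - L n' e\<bar> \<le> s"
      using s0 by (simp flip: diff_divide_distrib add: pos_divide_le_eq)
    then show ?thesis
      by (simp add: L_def s_def left_diff_distrib sum_subtractf)
  qed
  ultimately show ?thesis
    using that[of "real Q" "\<lambda>i. n i - n' i"] Q1 by simp
qed

text \<open>
  For a set of embeddings closed under conjugation, the real forms \<open>Re \<sigma> + Im \<sigma>\<close>
  treat real and complex embeddings uniformly: a conjugate pair yields \<open>Re \<sigma> \<plusminus> Im \<sigma>\<close>.
\<close>

lemma small_element:
  fixes B :: "'k::number_field set"
  assumes B: "finite B" "rat_space.independent B"
    and E: "E \<subseteq> embeddings" "\<And>\<sigma>. \<sigma> \<in> E \<Longrightarrow> cnj \<circ> \<sigma> \<in> E" "2 * card E < card B"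
    and \<delta>: "\<delta> > 0"
  obtains q Q where "q \<in> int_span B" "q \<noteq> 0" "Q > 0"
    "\<And>\<sigma>. \<sigma> \<in> embeddings \<Longrightarrow> cmod (\<sigma> q) \<le> Q"
    "\<And>\<sigma>. \<sigma> \<in> E \<Longrightarrow> cmod (\<sigma> q) \<le> \<delta> / Q"
proof -
  have fin: "finite (embeddings :: ('k \<Rightarrow> complex) set)" using card_embeddings_le by blast
  have finE: "finite E" using finite_subset[OF E(1) fin] .
  \<comment> \<open>The summand 1 makes \<open>A\<close> positive, so that it can be divided
    by.\<close>
  define A where "A = 1 + (\<Sum>\<sigma>\<in>(embeddings :: ('k \<Rightarrow> complex) set). \<Sum>b\<in>B. cmod (\<sigma> b))"
  have A1: "A \<ge> 1" unfolding A_def by (simp add: sum_nonneg)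
  have A: "(\<Sum>b\<in>B. cmod (\<sigma> b)) \<le> A" if "\<sigma> \<in> embeddings" for \<sigma>
    using member_le_sum[OF that _ fin, of "\<lambda>\<sigma>. \<Sum>b\<in>B. cmod (\<sigma> b)"]
    by (simp add: A_def sum_nonneg)
  \<comment> \<open>The bound finally returned is \<open>A * Q\<close> in place of \<open>Q\<close>,
    which costs the factor \<open>A\<close>; the factor 2 is for passing from the real forms to
    \<open>\<bar>Re\<bar> + \<bar>Im\<bar>\<close>.\<close>
  have \<delta>': "\<delta> / (2 * A) > 0" using \<delta> A1 by simp
  obtain n :: "'k \<Rightarrow> int" and Q :: real where Q: "Q > 0" "\<exists>b\<in>B. n b \<noteq> 0" "\<And>b. b \<in> B \<Longrightarrow> \<bar>n b\<bar> \<le> Q"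
    "\<And>\<sigma>. \<sigma> \<in> E \<Longrightarrow> \<bar>\<Sum>b\<in>B. real_of_int (n b) * (Re (\<sigma> b) + Im (\<sigma> b))\<bar> \<le> \<delta> / (2 * A) / Q"
  proof (rule small_linear_forms[OF B(1) finE E(3) \<delta>', of "\<lambda>\<sigma> b. Re (\<sigma> b) + Im (\<sigma> b)"], goal_cases)
    case (1 n Q)
    from 1(2-5) show ?case by (rule 1(1))
  qed
  define q where "q = (\<Sum>b\<in>B. of_int (n b) * b)"
  have emb_q: "\<sigma> q = (\<Sum>b\<in>B. of_int (n b) * \<sigma> b)" if "\<sigma> \<in> embeddings" for \<sigma>
    by (simp add: q_def embedding_sum[OF that] embeddingD[OF that] embedding_of_int[OF that])
  have "q \<noteq> 0"
  proof
    assume "q = 0"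
    then have "(\<Sum>b\<in>B. of_rat (of_int (n b)) * b) = 0" by (simp add: q_def)
    then have "\<forall>b\<in>B. (of_int (n b) :: rat) = 0"
      by (intro ballI rat_space.independentD[OF B(2,1) order_refl])
    then show False using Q(2) by simp
  qed
  moreover have "cmod (\<sigma> q) \<le> A * Q" if \<sigma>: "\<sigma> \<in> embeddings" for \<sigma>
  proof -
    have "cmod (\<sigma> q) \<le> (\<Sum>b\<in>B. Q * cmod (\<sigma> b))"
      unfolding emb_q[OF \<sigma>]
    proof (rule sum_norm_le)
      fix b assume "b \<in> B"
      then show "cmod (of_int (n b) * \<sigma> b) \<le> Q * cmod (\<sigma> b)"
        using Q(3) by (simp add: norm_mult mult_right_mono)
    qed
    also have "\<dots> \<le> A * Q"
      using A[OF \<sigma>] Q(1) by (simp flip: sum_distrib_left add: mult.commute)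
    finally show ?thesis .
  qed
  moreover have "cmod (\<sigma> q) \<le> \<delta> / (A * Q)" if \<sigma>: "\<sigma> \<in> E" for \<sigma>
  proof -
    have form: "\<bar>Re (\<tau> q) + Im (\<tau> q)\<bar> \<le> \<delta> / (2 * A) / Q" if "\<tau> \<in> E" for \<tau>
    proof -
      have "Re (\<tau> q) + Im (\<tau> q) = (\<Sum>b\<in>B. real_of_int (n b) * (Re (\<tau> b) + Im (\<tau> b)))"
        using that E(1) by (simp add: emb_q subset_iff algebra_simps sum.distrib)
      then show ?thesis using Q(4)[OF that] by simp
    qed
    \<comment> \<open>The form at the conjugate embedding, which also lies in \<open>E\<close>, is
      \<open>Re - Im\<close> at \<open>\<sigma>\<close>.\<close>
    have "\<bar>Re (\<sigma> q) + Im (\<sigma> q)\<bar> \<le> \<delta> / (2 * A) / Q" "\<bar>Re (\<sigma> q) - Im (\<sigma> q)\<bar> \<le> \<delta> / (2 * A) / Q"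
      using form[OF \<sigma>] form[OF E(2)[OF \<sigma>]] by simp_all
    then have "\<bar>Re (\<sigma> q)\<bar> + \<bar>Im (\<sigma> q)\<bar> \<le> 2 * (\<delta> / (2 * A) / Q)" using \<delta> A1 Q(1) by linarith
    also have "\<dots> = \<delta> / (A * Q)" by (simp add: field_simps)
    finally show ?thesis using cmod_le[of "\<sigma> q"] by linarith
  qed
  ultimately show ?thesis
    using that[of q "A * Q"] int_span_sum_base[of n B] A1 Q(1) by (simp add: q_def)
qed

section \<open>Places\<close>

text \<open>A place is an orbit under conjugation, so any member determines it; in particular
  distinct places are disjoint.\<close>

lemma place_eq:
  assumes "v \<in> arch_places" "\<sigma> \<in> v"
  shows "v = {\<sigma>, cnj \<circ> \<sigma>}" "\<sigma> \<in> embeddings"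
  using assms by (auto simp: arch_places_def cnj_embedding fun_eq_iff)

lemma place_emb_mem: "v \<in> arch_places \<Longrightarrow> place_emb v \<in> v"
  unfolding place_emb_def some_in_eq by (auto simp: arch_places_def)

lemma finite_arch_places: "finite (arch_places :: 'k::number_field place set)"
  unfolding arch_places_def using card_embeddings_le by blast

text \<open>A self-conjugate embedding takes real values, and since the reals are closed its
  completion could not contain \<open>\<i>\<close>.\<close>

lemma complex_place_card:
  assumes "v \<in> arch_places" "place_completion v = UNIV"
  shows "card v = 2"
proof -
  let ?\<sigma> = "place_emb v"
  have "cnj \<circ> ?\<sigma> \<noteq> ?\<sigma>"
  proof
    assume *: "cnj \<circ> ?\<sigma> = ?\<sigma>"
    have "range ?\<sigma> \<subseteq> \<real>"
      using fun_cong[OF *] by (auto simp: Reals_cnj_iff)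
    then have "closure (range ?\<sigma>) \<subseteq> \<real>"
      by (intro closure_minimal closed_complex_Reals)
    then have "\<i> \<in> \<real>" using assms(2) unfolding place_completion_def by blast
    then show False by (simp add: complex_is_Real_iff)
  qed
  then show ?thesis
    using place_eq(1)[OF assms(1) place_emb_mem[OF assms(1)]] by (metis card_2_iff)
qed

text \<open>Links the weight of \<open>T\<close> to embeddings: places are disjoint sets of
  embeddings, nonempty in general and with two elements when complex.\<close>

lemma place_weight_le:
  assumes T: "(T :: 'k::number_field place set) \<subseteq> arch_places"
  shows "card (real_places T) + 2 * card (complex_places T) \<le> card (\<Union>T)"
proof -
  have fin: "finite T" using finite_subset[OF T finite_arch_places] .
  have "(\<real> :: complex set) \<noteq> UNIV" by (metis UNIV_I complex_is_Real_iff complex.sel(2) one_neq_zero)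
  then have disj: "real_places T \<inter> complex_places T = {}"
    by (auto simp: real_places_def complex_places_def)
  have fin': "finite (real_places T)" "finite (complex_places T)"
    using fin by (simp_all add: real_places_def complex_places_def)
  have finv: "finite v" "v \<noteq> {}" if "v \<in> T" for v
    using that T by (auto simp: arch_places_def)
  have "card (real_places T) + 2 * card (complex_places T)
      = (\<Sum>v\<in>real_places T. 1) + (\<Sum>v\<in>complex_places T. 2)" by simp
  also have "\<dots> \<le> (\<Sum>v\<in>real_places T. card v) + (\<Sum>v\<in>complex_places T. card v)"
  proof (intro add_mono sum_mono)
    fix v assume "v \<in> real_places T"
    then have "v \<in> T" by (simp add: real_places_def)
    then show "1 \<le> card v" using finv[of v] by (simp add: Suc_le_eq card_gt_0_iff)
  next
    fix v assume "v \<in> complex_places T"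
    then show "2 \<le> card v" using T complex_place_card[of v] by (auto simp: complex_places_def)
  qed
  also have "\<dots> = (\<Sum>v\<in>real_places T \<union> complex_places T. card v)"
    using fin' disj by (simp add: sum.union_disjoint)
  also have "\<dots> \<le> (\<Sum>v\<in>T. card v)"
    using fin by (intro sum_mono2) (auto simp: real_places_def complex_places_def)
  also have "\<dots> = card (\<Union>T)"
  proof (rule card_Union_disjoint[symmetric])
    show "disjoint T"
    proof (rule disjointI)
      fix v w assume "v \<in> T" "w \<in> T" "v \<noteq> w"
      then show "v \<inter> w = {}" using T place_eq(1) by blast
    qed
  qed (use finv in blast)
  finally show ?thesis .
qed

text \<open>Nonemptiness is assumed because \<open>Max\<close> of the empty set is
  unspecified.\<close>

lemma norm_S_le:
  assumes "(arch_places :: 'k::number_field place set) \<noteq> {}"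
    and "\<And>v. v \<in> arch_places \<Longrightarrow> cmod (x v) \<le> C"
  shows "norm_S (x :: 'k arch_vec) \<le> C"
  unfolding norm_S_def using assms finite_arch_places by (subst Max_le_iff) auto

lemma norm_S_pos:
  assumes "(v :: 'k::number_field place) \<in> arch_places" "x v \<noteq> 0"
  shows "norm_S x > 0"
proof -
  have "cmod (x v) \<le> norm_S x"
    unfolding norm_S_def using assms(1) finite_arch_places by (intro Max_ge) auto
  moreover have "cmod (x v) > 0" using assms(2) by simp
  ultimately show ?thesis by linarith
qed

section \<open>Contradiction with bad approximability\<close>

theorem proposition5p5:
  fixes L :: "'k::number_field arch_vec set"
  assumes "L \<in> rational_subspaces"
  shows "L \<inter> BA = {}"
proof (rule ccontr)
  assume "L \<inter> BA \<noteq> {}"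
  then obtain y where y: "y \<in> L" "y \<in> BA" by blast
  obtain r :: 'k and T where T: "L = subspace_through (iota_S r) T" "T \<subseteq> arch_places"
    and weight: "real (card (real_places T) + 2 * card (complex_places T)) > real (field_degree TYPE('k)) / 2"
    using assms unfolding rational_subspaces_def by blast
  have yT: "y v = place_emb v r" if "v \<in> T" for v
    using y(1) that T by (auto simp: subspace_through_def iota_S_def)
  obtain c where c: "c > 0" and bad: "\<And>p q. p \<in> ring_of_integers \<Longrightarrow> q \<in> ring_of_integers \<Longrightarrow> q \<noteq> 0 \<Longrightarrow>
      norm_S (add_S (mult_S (iota_S q) y) (iota_S p)) > c * inverse (norm_S (iota_S q))"
    using y(2) unfolding BA_def badly_approximable_def by auto
  obtain B :: "'k set" where B: "finite B" "rat_space.independent B" "card B = field_degree TYPE('k)"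
    "\<And>x y. x \<in> int_span B \<Longrightarrow> y \<in> int_span B \<Longrightarrow> x * y \<in> int_span B"
    "int_span B \<subseteq> ring_of_integers"
    "\<And>x. \<exists>n::int. n > 0 \<and> of_int n * x \<in> int_span B"
    using integral_basis_exists by metis
  obtain N :: int where N: "N > 0" "of_int N * r \<in> int_span B" using B(6) by blast
  define E where "E = embeddings - \<Union>T"
  have fin: "finite (embeddings :: ('k \<Rightarrow> complex) set)"
    and card: "card (embeddings :: ('k \<Rightarrow> complex) set) \<le> field_degree TYPE('k)"
    using card_embeddings_le by auto
  have UT: "\<Union>T \<subseteq> embeddings" using T(2) place_eq(2) by blast
  \<comment> \<open>There are at most \<open>d\<close> embeddings and \<open>T\<close> covers more
    than \<open>d / 2\<close> of them, so fewer than \<open>d / 2\<close> remain in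
    \<open>E\<close>.\<close>
  have "card E + card (\<Union>T) = card (embeddings :: ('k \<Rightarrow> complex) set)"
    unfolding E_def using card_Diff_subset[OF finite_subset[OF UT fin] UT] card_mono[OF fin UT] by simp
  moreover have "real (field_degree TYPE('k)) < real (2 * (card (real_places T) + 2 * card (complex_places T)))"
    using weight by simp
  then have "field_degree TYPE('k) < 2 * (card (real_places T) + 2 * card (complex_places T))"
    by (simp only: of_nat_less_iff)
  ultimately have cardE: "2 * card E < card B"
    using card place_weight_le[OF T(2)] unfolding B(3) by presburger
  have cnjE: "cnj \<circ> \<sigma> \<in> E" if \<sigma>: "\<sigma> \<in> E" for \<sigma>
  proof -
    have "cnj \<circ> \<sigma> \<notin> \<Union>T"
    proof
      assume "cnj \<circ> \<sigma> \<in> \<Union>T"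
      then obtain v where v: "v \<in> T" "cnj \<circ> \<sigma> \<in> v" by blast
      then have "\<sigma> \<in> v" using place_eq(1)[of v "cnj \<circ> \<sigma>"] T(2) cnj_cnj_comp[of \<sigma>] by auto
      then show False using \<sigma> v(1) by (auto simp: E_def)
    qed
    then show ?thesis using \<sigma> cnj_embedding by (auto simp: E_def)
  qed
  \<comment> \<open>The empty set has weight 0, which cannot exceed \<open>d / 2\<close>.\<close>
  have "T \<noteq> {}" using weight by (auto simp: real_places_def complex_places_def)
  then have ne: "(arch_places :: 'k place set) \<noteq> {}" using T(2) by blast
  define Y where "Y = 1 + (\<Sum>v\<in>arch_places. cmod (y v - place_emb v r))"
  have Y1: "Y \<ge> 1" by (simp add: Y_def sum_nonneg)
  have Y: "cmod (y v - place_emb v r) \<le> Y" if "v \<in> arch_places" for v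
    using member_le_sum[OF that _ finite_arch_places, of "\<lambda>v. cmod (y v - place_emb v r)"]
    by (simp add: Y_def)
  \<comment> \<open>Chosen so that the error bound \<open>N * Y * (\<delta> / Q)\<close> equals
    \<open>c / (N * Q)\<close>.\<close>
  define \<delta> where "\<delta> = c / (of_int N ^ 2 * Y)"
  have \<delta>: "\<delta> > 0" using c N Y1 by (simp add: \<delta>_def)
  obtain q Q where q: "q \<in> int_span B" "q \<noteq> 0" and Q: "Q > 0"
    "\<And>\<sigma>. \<sigma> \<in> embeddings \<Longrightarrow> cmod (\<sigma> q) \<le> Q"
    "\<And>\<sigma>. \<sigma> \<in> E \<Longrightarrow> cmod (\<sigma> q) \<le> \<delta> / Q"
    using small_element[OF B(1,2) _ cnjE cardE \<delta>] by (metis Diff_subset E_def)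
  \<comment> \<open>Both are integral: \<open>of_int N * r\<close> and \<open>q\<close> lie in
    \<open>int_span B\<close>, which is closed under products.\<close>
  define q' p' where "q' = of_int N * q" and "p' = - (of_int N * r * q)"
  have "q' \<noteq> 0" "q' \<in> ring_of_integers" "p' \<in> ring_of_integers"
    using N q B(4,5) by (auto simp: q'_def p'_def intro: int_span_scale int_span_minus)
  note bad' = bad[OF this(3,2,1)]
  have emb: "place_emb v \<in> embeddings" if "v \<in> arch_places" for v
    using that by (rule place_emb_in_embeddings)
  have "norm_S (add_S (mult_S (iota_S q') y) (iota_S p')) \<le> of_int N * Y * (\<delta> / Q)"
  proof (rule norm_S_le[OF ne])
    fix v :: "'k place" assume v: "v \<in> arch_places"
    have eq: "add_S (mult_S (iota_S q') y) (iota_S p') v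
        = of_int N * (y v - place_emb v r) * place_emb v q"
      using v by (simp add: add_S_def mult_S_def iota_S_def q'_def p'_def embeddingD[OF emb[OF v]]
          embedding_minus[OF emb[OF v]] embedding_of_int[OF emb[OF v]] algebra_simps)
    show "cmod (add_S (mult_S (iota_S q') y) (iota_S p') v) \<le> of_int N * Y * (\<delta> / Q)"
    proof (cases "v \<in> T")
      case True
      then show ?thesis using yT N Y1 \<delta> Q(1) by (simp add: eq)
    next
      case False
      \<comment> \<open>The chosen embedding of \<open>v\<close> lies in no other place, so it
        belongs to \<open>E\<close> and \<open>q\<close> is small there.\<close>
      have "place_emb v \<notin> \<Union>T"
      proof
        assume "place_emb v \<in> \<Union>T"
        then obtain w where "w \<in> T" "place_emb v \<in> w" by blast
        then have "w = v" using place_eq(1)[of _ "place_emb v"] place_emb_mem[OF v] v T(2) by blast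
        then show False using False \<open>w \<in> T\<close> by blast
      qed
      then have "cmod (place_emb v q) \<le> \<delta> / Q" using Q(3) emb[OF v] by (simp add: E_def)
      then show ?thesis
        unfolding eq norm_mult using Y[OF v] N Y1 by (intro mult_mono) auto
    qed
  qed
  moreover have "norm_S (iota_S q') \<le> of_int N * Q"
  proof (rule norm_S_le[OF ne])
    fix v :: "'k place" assume v: "v \<in> arch_places"
    show "cmod (iota_S q' v) \<le> of_int N * Q"
      using v N Q(2)[OF emb[OF v]]
      by (simp add: iota_S_def q'_def embeddingD[OF emb[OF v]] embedding_of_int[OF emb[OF v]] norm_mult)
  qed
  moreover have pos: "norm_S (iota_S q') > 0"
  proof -
    obtain v :: "'k place" where v: "v \<in> arch_places" using ne by blast
    then show ?thesis
      using embedding_nonzero[OF emb[OF v] \<open>q' \<noteq> 0\<close>] by (intro norm_S_pos[OF v]) (simp add: iota_S_def)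
  qed
  \<comment> \<open>The error is at most \<open>c / (N * Q)\<close>, and this is at most
    \<open>c\<close> divided by the norm of \<open>q'\<close>, against \<open>bad'\<close>.\<close>
  moreover have "c * inverse (of_int N * Q) = of_int N * Y * (\<delta> / Q)"
    using N Q(1) Y1 by (simp add: \<delta>_def field_simps power2_eq_square)
  moreover have "c * inverse (of_int N * Q) \<le> c * inverse (norm_S (iota_S q'))"
    using calculation(2) pos c by (intro mult_left_mono le_imp_inverse_le) auto
  ultimately show False using bad' by linarith
qed

end
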